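(* Equip $\mathbb{R}^3$ with global coordinates $(x,y,t)$ and the Riemannian metric $ds^2=e^{2t}dx^2+e^{-2t}dy^2+dt^2$ (this is the model geometry $\mathbf{Sol}$). Let $a=(a_1,a_2,a_3,a_4)$ and $b=(b_1,b_2,b_3,b_4)$ be non-zero elements of $\mathbb{C}^4$, and define $f_1,f_2:\mathbf{Sol}\to\mathbb{C}$ by $f_1(x,y,t)=a_1+a_2x+a_3y+a_4xy$ and $f_2(x,y,t)=b_1+b_2x+b_3y+b_4xy$. Then $\tau(f_1)=\tau(f_2)=0$, so $f_1$ and $f_2$ are harmonic, and $\kappa(t^r,f_1)=\kappa(t^r,f_2)=0$ for any natural number $r$. Define a sequence $\{F_r\}_{r=0}^\infty$ of functions $F_r:\mathbf{Sol}\to\mathbb{C}$ by $$F_r(x,y,t)=t^{2r}\cdot f_1(x,y,t)+t^{2r+1}\cdot f_2(x,y,t).$$ Then $$\tau(F_r)=2r(2r-1)\cdot t^{2r-2}\cdot f_1+2r(2r+1)\cdot t^{2r-1}\cdot f_2,$$ and for each natural number $r$ the function $F_r:\mathbf{Sol}\to\mathbb{C}$ is proper $r$-harmonic.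
   Context: For a Riemannian manifold $(M,g)$, $\tau=\operatorname{div}\nabla$ denotes the Laplace-Beltrami operator acting on smooth complex-valued functions (the metric being extended complex-bilinearly), with $\tau^0(f)=f$ and $\tau^r(f)=\tau(\tau^{r-1}(f))$. The conformality operator is $\kappa(f,h)=g(\nabla f,\nabla h)$. For a positive integer $r$, a function $f:(M,g)\to\mathbb{C}$ is $r$-harmonic if $\tau^r(f)=0$, and proper $r$-harmonic if $\tau^r(f)=0$ and $\tau^{r-1}(f)$ does not vanish identically; harmonic means $1$-harmonic. On $\mathbf{Sol}$ the operators are $\tau(f)=e^{-2t}\frac{\partial^2 f}{\partial x^2}+e^{2t}\frac{\partial^2 f}{\partial y^2}+\frac{\partial^2 f}{\partial t^2}$ and $\kappa(f,h)=e^{-2t}\frac{\partial f}{\partial x}\frac{\partial h}{\partial x}+e^{2t}\frac{\partial f}{\partial y}\frac{\partial h}{\partial y}+\frac{\partial f}{\partial t}\frac{\partial h}{\partial t}$.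
   Formalization: The last claim is proved with a corrected index: F_r is proper (r+1)-harmonic for every r ≥ 0; as printed (proper r-harmonic) it is false, since τ(F_1) = 2f_1 + 6t f_2 is not identically zero. *)

theory Defs
  imports "HOL-Analysis.Analysis"
begin

text \<open>
  Riemannian manifolds with a global chart: the manifold is \<open>real ^ 'n\<close>, a metric is given by its
  matrix \<open>(g\<^sub>i\<^sub>j)\<close> at each point, and complexified vector fields by their components with respect
  to the coordinate frame.
\<close>

definition partial_deriv :: "'n::finite \<Rightarrow> (real^'n \<Rightarrow> complex) \<Rightarrow> real^'n \<Rightarrow> complex" where
  "partial_deriv i f = (\<lambda>p. vector_derivative (\<lambda>s. f (p + s *\<^sub>R axis i 1)) (at 0))"

text \<open>\<open>vector_derivative\<close> is a junk value where the derivative does not exist; smoothness below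
  demands that every iterated partial derivative, of every order, is differentiable.\<close>

definition smooth_fun :: "(real^'n::finite \<Rightarrow> complex) \<Rightarrow> bool" where
  "smooth_fun f \<longleftrightarrow> (\<forall>is. foldr partial_deriv is f differentiable_on UNIV)"

definition riemannian_metric :: "(real^'n \<Rightarrow> real^'n^'n::finite) \<Rightarrow> bool" where
  "riemannian_metric g \<longleftrightarrow>
     (\<forall>i j. smooth_fun (\<lambda>p. complex_of_real (g p $ i $ j))) \<and>
     (\<forall>p. transpose (g p) = g p \<and> (\<forall>v. v \<noteq> 0 \<longrightarrow> v \<bullet> (g p *v v) > 0))"

text \<open>The metric extended complex-bilinearly (no conjugation).\<close>

definition metric_bilinear ::
    "(real^'n \<Rightarrow> real^'n^'n::finite) \<Rightarrow> real^'n \<Rightarrow> complex^'n \<Rightarrow> complex^'n \<Rightarrow> complex" where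
  "metric_bilinear g p v w = (\<Sum>i\<in>UNIV. \<Sum>j\<in>UNIV. of_real (g p $ i $ j) * v $ i * w $ j)"

definition grad ::
    "(real^'n \<Rightarrow> real^'n^'n::finite) \<Rightarrow> (real^'n \<Rightarrow> complex) \<Rightarrow> real^'n \<Rightarrow> complex^'n" where
  "grad g f = (\<lambda>p. \<chi> i. \<Sum>j\<in>UNIV. of_real (matrix_inv (g p) $ i $ j) * partial_deriv j f p)"

definition divergence ::
    "(real^'n \<Rightarrow> real^'n^'n::finite) \<Rightarrow> (real^'n \<Rightarrow> complex^'n) \<Rightarrow> real^'n \<Rightarrow> complex" where
  "divergence g X = (\<lambda>p. (1 / of_real (sqrt (det (g p)))) *
     (\<Sum>i\<in>UNIV. partial_deriv i (\<lambda>q. of_real (sqrt (det (g q))) * X q $ i) p))"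

definition laplace_beltrami ::
    "(real^'n \<Rightarrow> real^'n^'n::finite) \<Rightarrow> (real^'n \<Rightarrow> complex) \<Rightarrow> real^'n \<Rightarrow> complex" where
  "laplace_beltrami g f = divergence g (grad g f)"

definition conformality ::
    "(real^'n \<Rightarrow> real^'n^'n::finite) \<Rightarrow> (real^'n \<Rightarrow> complex) \<Rightarrow> (real^'n \<Rightarrow> complex) \<Rightarrow>
     real^'n \<Rightarrow> complex" where
  "conformality g f h = (\<lambda>p. metric_bilinear g p (grad g f p) (grad g h p))"

definition r_harmonic ::
    "(real^'n \<Rightarrow> real^'n^'n::finite) \<Rightarrow> nat \<Rightarrow> (real^'n \<Rightarrow> complex) \<Rightarrow> bool" where
  "r_harmonic g r f \<longleftrightarrow>
     0 < r \<and> smooth_fun f \<and> (\<forall>p. (laplace_beltrami g ^^ r) f p = 0)"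

definition proper_r_harmonic ::
    "(real^'n \<Rightarrow> real^'n^'n::finite) \<Rightarrow> nat \<Rightarrow> (real^'n \<Rightarrow> complex) \<Rightarrow> bool" where
  "proper_r_harmonic g r f \<longleftrightarrow>
     r_harmonic g r f \<and> (\<exists>p. (laplace_beltrami g ^^ (r - 1)) f p \<noteq> 0)"

abbreviation harmonic ::
    "(real^'n \<Rightarrow> real^'n^'n::finite) \<Rightarrow> (real^'n \<Rightarrow> complex) \<Rightarrow> bool" where
  "harmonic g f \<equiv> r_harmonic g 1 f"

text \<open>The geometry Sol, with \<open>x = p $ 1\<close>, \<open>y = p $ 2\<close>, \<open>t = p $ 3\<close>.\<close>

definition sol_metric :: "real^3 \<Rightarrow> real^3^3" where
  "sol_metric p = vector [vector [exp (2 * p $ 3), 0, 0],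
                          vector [0, exp (- 2 * p $ 3), 0],
                          vector [0, 0, 1]]"

lemma smooth_fun_coinduct:
  assumes "f \<in> S" and "\<And>g. g \<in> S \<Longrightarrow> g differentiable_on UNIV"
    and "\<And>g i. g \<in> S \<Longrightarrow> partial_deriv i g \<in> S"
  shows "smooth_fun f"
proof -
  have "foldr partial_deriv js f \<in> S" for js
    by (induction js) (use assms in auto)
  then show ?thesis
    by (simp add: smooth_fun_def assms(2))
qed

lemma smooth_fun_exp:
  "smooth_fun (\<lambda>p::real^3. complex_of_real (c * exp (k * p $ 3)))"
proof (rule smooth_fun_coinduct)
  let ?S = "{\<lambda>p::real^3. complex_of_real (c * exp (k * p $ 3)) |c k. True}"
  show "(\<lambda>p::real^3. complex_of_real (c * exp (k * p $ 3))) \<in> ?S"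
    by blast
  fix g assume "g \<in> ?S"
  then obtain c k where g: "g = (\<lambda>p. complex_of_real (c * exp (k * p $ 3)))"
    by blast
  have "((\<lambda>p::real^3. c * exp (k * p $ 3)) has_derivative (\<lambda>h. c * (exp (k * p $ 3) * (k * h $ 3))))
          (at p)" for p
    by (auto intro!: derivative_eq_intros bounded_linear.has_derivative[OF bounded_linear_vec_nth])
  from has_derivative_of_real[OF this] show "g differentiable_on UNIV"
    unfolding g differentiable_on_def differentiable_def by blast
  fix i :: 3
  let ?e = "(axis i 1 :: real^3) $ 3"
  have "((\<lambda>s. complex_of_real (c * exp (k * (p + s *\<^sub>R axis i 1) $ 3))) has_vector_derivative
          complex_of_real (c * k * ?e * exp (k * p $ 3))) (at 0)" for p
    by (rule has_vector_derivative_of_real) (auto intro!: derivative_eq_intros)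
  then have "partial_deriv i g = (\<lambda>p. complex_of_real (c * k * ?e * exp (k * p $ 3)))"
    unfolding partial_deriv_def g by (intro ext vector_derivative_at)
  then show "partial_deriv i g \<in> ?S"
    by blast
qed

lemma riemannian_metric_sol: "riemannian_metric sol_metric"
proof -
  have "smooth_fun (\<lambda>p. complex_of_real (sol_metric p $ i $ j))" for i j
    using exhaust_3[of i] exhaust_3[of j]
      smooth_fun_exp[of 0 0] smooth_fun_exp[of 1 0] smooth_fun_exp[of 1 2] smooth_fun_exp[of 1 "-2"]
    by (auto simp: sol_metric_def)
  moreover have "transpose (sol_metric p) = sol_metric p" for p
    by (simp add: transpose_def sol_metric_def vec_eq_iff forall_3)
  moreover have "v \<bullet> (sol_metric p *v v) > 0" if "v \<noteq> 0" for p v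
  proof -
    have "v \<bullet> (sol_metric p *v v) =
        exp (2 * p $ 3) * (v $ 1)\<^sup>2 + exp (- 2 * p $ 3) * (v $ 2)\<^sup>2 + (v $ 3)\<^sup>2"
      by (simp add: inner_vec_def matrix_vector_mult_def sol_metric_def sum_3 power2_eq_square)
    moreover have "v $ 1 \<noteq> 0 \<or> v $ 2 \<noteq> 0 \<or> v $ 3 \<noteq> 0"
      using that by (auto simp: vec_eq_iff forall_3)
    ultimately show ?thesis
      by (auto simp: add_pos_nonneg add_nonneg_pos)
  qed
  ultimately show ?thesis
    by (simp add: riemannian_metric_def)
qed

text \<open>The general operators specialise to the familiar coordinate expressions on Sol.\<close>

lemma det_sol_metric: "det (sol_metric p) = 1"
  by (simp add: sol_metric_def det_3 exp_minus)

lemma matrix_inv_sol_metric: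
  "matrix_inv (sol_metric p) = vector [vector [exp (- 2 * p $ 3), 0, 0],
                                       vector [0, exp (2 * p $ 3), 0],
                                       vector [0, 0, 1]]" (is "_ = ?B")
proof -
  have 1: "sol_metric p ** ?B = mat 1" "?B ** sol_metric p = mat 1"
    by (simp_all add: sol_metric_def matrix_matrix_mult_def mat_def vec_eq_iff forall_3 sum_3
        exp_minus)
  then have 2: "matrix_inv (sol_metric p) ** sol_metric p = mat 1"
    unfolding matrix_inv_def by (rule someI2[where a = ?B, OF conjI]) auto
  have "matrix_inv (sol_metric p) = matrix_inv (sol_metric p) ** (sol_metric p ** ?B)"
    by (simp only: 1 matrix_mul_rid)
  also have "\<dots> = ?B"
    by (simp add: matrix_mul_assoc 2)
  finally show ?thesis .
qed

lemma grad_sol: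
  "grad sol_metric f p = vector [of_real (exp (- 2 * p $ 3)) * partial_deriv 1 f p,
                                 of_real (exp (2 * p $ 3)) * partial_deriv 2 f p,
                                 partial_deriv 3 f p]"
  by (simp add: grad_def matrix_inv_sol_metric vec_eq_iff forall_3 sum_3)

lemma conformality_sol:
  "conformality sol_metric f h p =
     of_real (exp (- 2 * p $ 3)) * partial_deriv 1 f p * partial_deriv 1 h p +
     of_real (exp (2 * p $ 3)) * partial_deriv 2 f p * partial_deriv 2 h p +
     partial_deriv 3 f p * partial_deriv 3 h p"
  by (simp add: conformality_def metric_bilinear_def grad_sol sum_3 sol_metric_def exp_minus
      field_simps)

lemma smooth_fun_partial_deriv:
  assumes "smooth_fun f"
  shows "smooth_fun (partial_deriv i f)"
  unfolding smooth_fun_def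
proof
  fix js
  show "foldr partial_deriv js (partial_deriv i f) differentiable_on UNIV"
    using assms[unfolded smooth_fun_def, rule_format, of "js @ [i]"] by simp
qed

lemma smooth_fun_line_differentiable:
  assumes "smooth_fun f"
  shows "(\<lambda>s. f (p + s *\<^sub>R axis i 1)) differentiable (at 0)"
proof -
  have "f differentiable (at (p + 0 *\<^sub>R axis i 1))"
    using assms[unfolded smooth_fun_def, rule_format, of "[]"] by (simp add: differentiable_on_def)
  moreover have "(\<lambda>s. p + s *\<^sub>R axis i 1) differentiable (at (0::real))"
    by (intro derivative_intros)
  ultimately show ?thesis
    using differentiable_chain_at[of "\<lambda>s. p + s *\<^sub>R axis i 1" 0 f] by (simp add: o_def)
qed

lemma partial_deriv_cmult:
  assumes "smooth_fun f" and c: "\<And>p s. c (p + s *\<^sub>R axis i 1) = c p"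
  shows "partial_deriv i (\<lambda>q. c q * f q) p = c p * partial_deriv i f p"
  unfolding partial_deriv_def c
  using smooth_fun_line_differentiable[OF assms(1)]
  by (intro vector_derivative_at has_vector_derivative_mult_right)
     (simp add: vector_derivative_works)

lemma laplace_beltrami_sol:
  assumes "smooth_fun f"
  shows "laplace_beltrami sol_metric f p =
     of_real (exp (- 2 * p $ 3)) * partial_deriv 1 (partial_deriv 1 f) p +
     of_real (exp (2 * p $ 3)) * partial_deriv 2 (partial_deriv 2 f) p +
     partial_deriv 3 (partial_deriv 3 f) p"
proof -
  have "partial_deriv 1 (\<lambda>q. of_real (exp (- 2 * q $ 3)) * partial_deriv 1 f q) p =
          of_real (exp (- 2 * p $ 3)) * partial_deriv 1 (partial_deriv 1 f) p"
    by (rule partial_deriv_cmult) (simp_all add: assms smooth_fun_partial_deriv axis_def)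
  moreover have "partial_deriv 2 (\<lambda>q. of_real (exp (2 * q $ 3)) * partial_deriv 2 f q) p =
          of_real (exp (2 * p $ 3)) * partial_deriv 2 (partial_deriv 2 f) p"
    by (rule partial_deriv_cmult) (simp_all add: assms smooth_fun_partial_deriv axis_def)
  ultimately show ?thesis
    by (simp add: laplace_beltrami_def divergence_def det_sol_metric sum_3 grad_sol)
qed

end

theory Submission
  imports Defs "HOL-Computational_Algebra.Polynomial"
begin

text \<open>
  The coordinate expression of the Laplacian on Sol differentiates twice in \<open>x\<close> and twice in \<open>y\<close>,
  so it acts on functions which are affine in \<open>x\<close> and in \<open>y\<close> separately simply as the flat operator
  \<open>\<partial>\<^sup>2/\<partial>t\<^sup>2\<close>.  All functions in the theorem have this form with polynomial dependence on \<open>t\<close>, and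
  this class is closed under partial derivatives, which gives smoothness as well.  The Laplacian
  thus becomes the second derivative of the polynomial coefficients
  (\<open>laplace_beltrami_biaffine\<close>).  The coefficients of the \<open>r\<close>-th function are
  \<open>a\<^sub>i t\<^bsup>2r\<^esup> + b\<^sub>i t\<^bsup>2r+1\<^esup>\<close>, which are annihilated by \<open>2r + 2\<close> derivatives, while \<open>2r\<close> derivatives
  leave at \<open>t = 0\<close> the nonzero multiples \<open>(2r)! a\<^sub>i\<close> of the coefficients of the first function.
  That function does not vanish identically, because its four coefficients can be recovered from
  its values at the corners of the unit square.
\<close>

definition biaffine :: "complex poly^4 \<Rightarrow> real^3 \<Rightarrow> complex" where
  "biaffine u p = poly (u$1) (of_real (p$3)) + poly (u$2) (of_real (p$3)) * of_real (p$1)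
     + poly (u$3) (of_real (p$3)) * of_real (p$2)
     + poly (u$4) (of_real (p$3)) * of_real (p$1) * of_real (p$2)"

lemma vector_4_nth [simp]:
  "(vector [c, d, e, f] :: 'a::zero^4) $ 1 = c"
  "(vector [c, d, e, f] :: 'a::zero^4) $ 2 = d"
  "(vector [c, d, e, f] :: 'a::zero^4) $ 3 = e"
  "(vector [c, d, e, f] :: 'a::zero^4) $ 4 = f"
  by (simp_all add: vector_def)

text \<open>Restricted to a coordinate line, the functions of interest extend to the complex plane, so
  that the rules for complex derivatives apply.\<close>

lemma partial_deriv_eqI:
  assumes "\<And>s. f (p + s *\<^sub>R axis i 1) = g (of_real s)" and "(g has_field_derivative D) (at 0)"
  shows "partial_deriv i f p = D"
  unfolding partial_deriv_def assms(1)
  using has_vector_derivative_real_field[of g D 0] assms(2)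
  by (intro vector_derivative_at) auto

lemma partial_deriv_biaffine:
  "partial_deriv 1 (biaffine u) = biaffine (vector [u$2, 0, u$4, 0])" (is ?x)
  "partial_deriv 2 (biaffine u) = biaffine (vector [u$3, u$4, 0, 0])" (is ?y)
  "partial_deriv 3 (biaffine u) = biaffine (\<chi> i. pderiv (u$i))" (is ?t)
proof -
  show ?x
  proof
    fix p :: "real^3"
    let ?P = "\<lambda>i. poly (u$i) (of_real (p$3))"
    show "partial_deriv 1 (biaffine u) p = biaffine (vector [u$2, 0, u$4, 0]) p"
      by (rule partial_deriv_eqI[where g = "\<lambda>z. ?P 1 + ?P 2 * (of_real (p$1) + z)
            + ?P 3 * of_real (p$2) + ?P 4 * (of_real (p$1) + z) * of_real (p$2)"])
        (auto simp: biaffine_def axis_def intro!: derivative_eq_intros)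
  qed
  show ?y
  proof
    fix p :: "real^3"
    let ?P = "\<lambda>i. poly (u$i) (of_real (p$3))"
    show "partial_deriv 2 (biaffine u) p = biaffine (vector [u$3, u$4, 0, 0]) p"
      by (rule partial_deriv_eqI[where g = "\<lambda>z. ?P 1 + ?P 2 * of_real (p$1)
            + ?P 3 * (of_real (p$2) + z) + ?P 4 * of_real (p$1) * (of_real (p$2) + z)"])
        (auto simp: biaffine_def axis_def intro!: derivative_eq_intros)
  qed
  show ?t
  proof
    fix p :: "real^3"
    let ?P = "\<lambda>i z. poly (u$i) (of_real (p$3) + z)"
    have P: "(?P i has_field_derivative poly (pderiv (u$i)) (of_real (p$3))) (at 0)" for i
      using DERIV_shift[of "poly (u$i)" "poly (pderiv (u$i)) (of_real (p$3))" 0 "of_real (p$3)"]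
      by (simp add: add.commute)
    show "partial_deriv 3 (biaffine u) p = biaffine (\<chi> i. pderiv (u$i)) p"
      by (rule partial_deriv_eqI[where g = "\<lambda>z. ?P 1 z + ?P 2 z * of_real (p$1)
            + ?P 3 z * of_real (p$2) + ?P 4 z * of_real (p$1) * of_real (p$2)"])
        (auto simp: biaffine_def axis_def intro!: derivative_eq_intros P)
  qed
qed

lemma smooth_fun_biaffine: "smooth_fun (biaffine u)"
proof (rule smooth_fun_coinduct)
  show "biaffine u \<in> range biaffine"
    by blast
next
  fix g assume "g \<in> range biaffine"
  then obtain v where g: "g = biaffine v" by blast
  have coord: "(\<lambda>p::real^3. complex_of_real (p$i)) differentiable (at p)" for i p
    by (intro bounded_linear_imp_differentiable bounded_linear_compose[OF bounded_linear_of_real]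
        bounded_linear_vec_nth)
  have "poly c differentiable (at z)" for c :: "complex poly" and z
    using poly_DERIV[of c z] by (auto simp: has_field_derivative_def differentiable_def)
  from differentiable_chain_at[OF coord this]
  have "(\<lambda>p::real^3. poly c (complex_of_real (p$3))) differentiable (at p)" for c p
    by (simp add: o_def)
  then show "g differentiable_on UNIV"
    unfolding g differentiable_on_def biaffine_def
    by (intro ballI differentiable_add differentiable_mult coord) auto
next
  fix g i assume "g \<in> range biaffine"
  then show "partial_deriv i g \<in> range biaffine"
    using exhaust_3[of i] by (auto simp: partial_deriv_biaffine)
qed

lemma laplace_beltrami_biaffine:
  "laplace_beltrami sol_metric (biaffine u) = biaffine (\<chi> i. pderiv (pderiv (u$i)))"
proof
  fix p :: "real^3"
  show "laplace_beltrami sol_metric (biaffine u) p = biaffine (\<chi> i. pderiv (pderiv (u$i))) p"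
    by (simp add: laplace_beltrami_sol smooth_fun_biaffine partial_deriv_biaffine)
      (simp add: biaffine_def)
qed

lemma laplace_beltrami_funpow_biaffine:
  "(laplace_beltrami sol_metric ^^ k) (biaffine u) = biaffine (\<chi> i. (pderiv ^^ (2 * k)) (u$i))"
  by (induction k) (simp_all add: laplace_beltrami_biaffine)

text \<open>The gradients are orthogonal, one being tangent to the \<open>t\<close>-lines and the other to the planes
  of constant \<open>t\<close>.\<close>

lemma conformality_power_biaffine:
  "conformality sol_metric (\<lambda>q. of_real (q$3) ^ r) (biaffine (\<chi> i. [:c$i:])) p = 0"
proof -
  have "partial_deriv 1 (\<lambda>q. of_real (q$3) ^ r) p = 0" "partial_deriv 2 (\<lambda>q. of_real (q$3) ^ r) p = 0"
    by (rule partial_deriv_eqI[where g = "\<lambda>z. of_real (p$3) ^ r"]; simp add: axis_def)+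
  then show ?thesis
    by (simp add: conformality_sol partial_deriv_biaffine) (simp add: biaffine_def)
qed

lemma biaffine_const_nonzero:
  fixes c :: "complex^4"
  assumes "c \<noteq> 0"
  obtains x y where "c$1 + c$2 * of_real x + c$3 * of_real y + c$4 * of_real x * of_real y \<noteq> 0"
proof (rule ccontr)
  assume "\<not> thesis"
  then have *: "c$1 + c$2 * of_real x + c$3 * of_real y + c$4 * of_real x * of_real y = 0" for x y
    using that by blast
  from *[of 0 0] *[of 1 0] *[of 0 1] *[of 1 1] have "c = 0"
    by (auto simp: vec_eq_iff forall_4)
  with assms show False by simp
qed

lemma biaffine_monom_sum:
  fixes a b :: "complex^4"
  shows "biaffine (\<chi> i. monom (a$i) m + monom (b$i) n) p =
     of_real (p$3) ^ m * (a$1 + a$2 * of_real (p$1) + a$3 * of_real (p$2)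
        + a$4 * of_real (p$1) * of_real (p$2))
   + of_real (p$3) ^ n * (b$1 + b$2 * of_real (p$1) + b$3 * of_real (p$2)
        + b$4 * of_real (p$1) * of_real (p$2))"
  by (simp add: biaffine_def poly_monom algebra_simps)

theorem mainTheorem1:
  fixes a b :: "complex^4"
    and f1 f2 :: "real^3 \<Rightarrow> complex"
    and F :: "nat \<Rightarrow> real^3 \<Rightarrow> complex"
  assumes a: "a \<noteq> 0" and b: "b \<noteq> 0"
    and f1: "\<And>p. f1 p = a$1 + a$2 * of_real (p$1) + a$3 * of_real (p$2)
                        + a$4 * of_real (p$1) * of_real (p$2)"
    and f2: "\<And>p. f2 p = b$1 + b$2 * of_real (p$1) + b$3 * of_real (p$2)
                        + b$4 * of_real (p$1) * of_real (p$2)"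
    and F: "\<And>r p. F r p = of_real (p$3) ^ (2 * r) * f1 p + of_real (p$3) ^ (2 * r + 1) * f2 p"
  shows "(\<forall>p. laplace_beltrami sol_metric f1 p = 0) \<and> (\<forall>p. laplace_beltrami sol_metric f2 p = 0)
    \<and> harmonic sol_metric f1 \<and> harmonic sol_metric f2
    \<and> (\<forall>(r::nat) p. conformality sol_metric (\<lambda>q. of_real (q$3) ^ r) f1 p = 0
                  \<and> conformality sol_metric (\<lambda>q. of_real (q$3) ^ r) f2 p = 0)
    \<and> (\<forall>r p. laplace_beltrami sol_metric (F r) p =
          of_real (2 * real r * (2 * real r - 1)) * of_real (p$3) powi (2 * int r - 2) * f1 p
        + of_real (2 * real r * (2 * real r + 1)) * of_real (p$3) powi (2 * int r - 1) * f2 p)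
    \<and> (\<forall>r. proper_r_harmonic sol_metric (r + 1) (F r))"
proof (intro conjI)
  have f: "f1 = biaffine (\<chi> i. [:a$i:])" "f2 = biaffine (\<chi> i. [:b$i:])"
    by (auto simp: f1 f2 biaffine_def)
  have Fr: "F r = biaffine (\<chi> i. monom (a$i) (2 * r) + monom (b$i) (2 * r + 1))" for r
    unfolding biaffine_monom_sum fun_eq_iff F f1 f2 by simp
  have harm: "laplace_beltrami sol_metric (biaffine (\<chi> i. [:c$i:])) p = 0" for c :: "complex^4" and p
    unfolding laplace_beltrami_biaffine by (simp add: biaffine_def)
  show "\<forall>p. laplace_beltrami sol_metric f1 p = 0" "\<forall>p. laplace_beltrami sol_metric f2 p = 0"
    by (simp_all add: f harm)
  then show "harmonic sol_metric f1" "harmonic sol_metric f2"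
    by (simp_all add: r_harmonic_def f smooth_fun_biaffine)
  show "\<forall>(r::nat) p. conformality sol_metric (\<lambda>q. of_real (q$3) ^ r) f1 p = 0
                  \<and> conformality sol_metric (\<lambda>q. of_real (q$3) ^ r) f2 p = 0"
    by (simp add: f conformality_power_biaffine)
  show "\<forall>r p. laplace_beltrami sol_metric (F r) p =
          of_real (2 * real r * (2 * real r - 1)) * of_real (p$3) powi (2 * int r - 2) * f1 p
        + of_real (2 * real r * (2 * real r + 1)) * of_real (p$3) powi (2 * int r - 1) * f2 p"
  proof (intro allI)
    fix r p
    let ?m = "of_real (2 * real r * (2 * real r - 1)) :: complex"
    let ?n = "of_real (2 * real r * (2 * real r + 1)) :: complex"
    have c: "pderiv (pderiv (monom (a$i) (2 * r) + monom (b$i) (2 * r + 1))) =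
        monom ((?m *s a)$i) (2 * r - 2) + monom ((?n *s b)$i) (2 * r - 1)" for i
      by (cases r) (simp_all add: pderiv_add pderiv_monom algebra_simps)
    have "laplace_beltrami sol_metric (F r) p =
        ?m * of_real (p$3) ^ (2 * r - 2) * f1 p + ?n * of_real (p$3) ^ (2 * r - 1) * f2 p"
      unfolding Fr laplace_beltrami_biaffine vec_lambda_beta c biaffine_monom_sum f1 f2
      by (simp add: algebra_simps)
    \<comment> \<open>For \<open>r = 0\<close> truncated and integer exponents disagree, but then both constants vanish.\<close>
    also have "?m * of_real (p$3) ^ (2 * r - 2) = ?m * of_real (p$3) powi (2 * int r - 2)"
      by (cases r) (auto simp: power_int_def nat_diff_distrib nat_mult_distrib nat_add_distrib)
    also have "?n * of_real (p$3) ^ (2 * r - 1) = ?n * of_real (p$3) powi (2 * int r - 1)"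
      by (cases r) (auto simp: power_int_def nat_diff_distrib nat_mult_distrib nat_add_distrib)
    finally show "laplace_beltrami sol_metric (F r) p =
        ?m * of_real (p$3) powi (2 * int r - 2) * f1 p
      + ?n * of_real (p$3) powi (2 * int r - 1) * f2 p" .
  qed
  show "\<forall>r. proper_r_harmonic sol_metric (r + 1) (F r)"
  proof
    fix r
    have low: "(pderiv ^^ (2 * r)) (monom (a$i) (2 * r) + monom (b$i) (2 * r + 1)) =
        monom ((fact (2 * r) *s a)$i) 0 + monom ((fact (2 * r + 1) *s b)$i) 1" for i
    proof (rule poly_eqI)
      have "fact (2 * r + 1) = (pochhammer 2 (2 * r) :: complex)"
        using pochhammer_rec[of "1::complex" "2 * r"] by (simp add: pochhammer_fact)
      then show "coeff ((pderiv ^^ (2 * r)) (monom (a$i) (2 * r) + monom (b$i) (2 * r + 1))) n =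
          coeff (monom ((fact (2 * r) *s a)$i) 0 + monom ((fact (2 * r + 1) *s b)$i) 1) n" for n
        unfolding coeff_higher_pderiv by (auto simp: pochhammer_fact)
    qed
    have high: "(pderiv ^^ (2 * (r + 1))) (monom (a$i) (2 * r) + monom (b$i) (2 * r + 1)) = 0" for i
      using low[of i] by (simp add: pderiv_add pderiv_monom)
    have "(laplace_beltrami sol_metric ^^ (r + 1)) (F r) p = 0" for p
      unfolding Fr laplace_beltrami_funpow_biaffine vec_lambda_beta high by (simp add: biaffine_def)
    moreover have "smooth_fun (F r)"
      by (simp add: Fr smooth_fun_biaffine)
    moreover obtain x y where
      xy: "a$1 + a$2 * of_real x + a$3 * of_real y + a$4 * of_real x * of_real y \<noteq> 0"
      using biaffine_const_nonzero[OF a] by blast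
    have "(laplace_beltrami sol_metric ^^ r) (F r) (vector [x, y, 0]) =
        fact (2 * r) * (a$1 + a$2 * of_real x + a$3 * of_real y + a$4 * of_real x * of_real y)"
      unfolding Fr laplace_beltrami_funpow_biaffine vec_lambda_beta low biaffine_monom_sum
      by (simp add: algebra_simps)
    with xy have "\<exists>p. (laplace_beltrami sol_metric ^^ r) (F r) p \<noteq> 0"
      by (metis fact_nonzero mult_eq_0_iff)
    ultimately show "proper_r_harmonic sol_metric (r + 1) (F r)"
      by (simp add: proper_r_harmonic_def r_harmonic_def)
  qed
qed

end
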